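(* Let $X$ be a Tychonoff space. The free Abelian topological group $A(X)$ on $X$ admits a local $\omega^\omega$-base if and only if the finest compatible uniformity on $X$ has an $\omega^\omega$-base.
   Context: The set $\omega^\omega$ of all functions $\omega\to\omega$ carries the pointwise partial order. A filter $\mathcal F$ admits an $\omega^\omega$-base if there is a family $\{F_\alpha:\alpha\in\omega^\omega\}\subseteq\mathcal F$ such that $\alpha\le\beta$ implies $F_\beta\subseteq F_\alpha$ and every element of $\mathcal F$ contains some $F_\alpha$. A uniformity has an $\omega^\omega$-base if its filter of entourages does; a topological group has a local $\omega^\omega$-base if the filter of neighbourhoods of its identity does. The free Abelian topological group $A(X)$ is the Abelian topological group which contains $X$ as a topological subspace, is algebraically generated by $X$, and has the property that every continuous map from $X$ to an Abelian topological group extends to a continuous homomorphism on $A(X)$. The finest compatible uniformity on $X$ is the finest uniformity inducing the topology of $X$. *)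

theory Defs
  imports "HOL-Analysis.Analysis" "HOL-Algebra.Free_Abelian_Groups"
begin

definition tychonoff_space :: "'a topology \<Rightarrow> bool" where
  "tychonoff_space X \<longleftrightarrow> completely_regular_space X \<and> Hausdorff_space X"

text \<open>The order on \<^typ>\<open>nat \<Rightarrow> nat\<close> is the pointwise one. A set \<open>F\<close> belongs to the filter
  \<open>\<F>\<close> iff \<open>eventually (\<lambda>x. x \<in> F) \<F>\<close>. A filter on a proper subset \<open>S\<close> of the type is
  represented by the HOL filter that it generates, which also contains sets sticking out of
  \<open>S\<close>; intersecting with \<open>S\<close> shows that this does not affect the existence of a base.\<close>

definition has_omega_omega_base :: "'a filter \<Rightarrow> bool" where
  "has_omega_omega_base \<F> \<longleftrightarrow>
     (\<exists>F :: (nat \<Rightarrow> nat) \<Rightarrow> 'a set.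
        (\<forall>\<alpha>. eventually (\<lambda>x. x \<in> F \<alpha>) \<F>) \<and>
        (\<forall>\<alpha> \<beta>. \<alpha> \<le> \<beta> \<longrightarrow> F \<beta> \<subseteq> F \<alpha>) \<and>
        (\<forall>A. eventually (\<lambda>x. x \<in> A) \<F> \<longrightarrow> (\<exists>\<alpha>. F \<alpha> \<subseteq> A)))"

text \<open>Uniformities on a set, following the axioms of the class \<^class>\<open>uniform_space\<close>.\<close>

definition uniformity_on :: "'a set \<Rightarrow> ('a \<times> 'a) filter \<Rightarrow> bool" where
  "uniformity_on S \<U> \<longleftrightarrow>
     \<U> \<le> principal (S \<times> S) \<and>
     (\<forall>E. eventually E \<U> \<longrightarrow> (\<forall>x\<in>S. E (x, x))) \<and>
     (\<forall>E. eventually E \<U> \<longrightarrow> eventually (\<lambda>(x, y). E (y, x)) \<U>) \<and>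
     (\<forall>E. eventually E \<U> \<longrightarrow>
        (\<exists>D. eventually D \<U> \<and> (\<forall>x y z. D (x, y) \<longrightarrow> D (y, z) \<longrightarrow> E (x, z))))"

definition compatible_uniformity :: "'a topology \<Rightarrow> ('a \<times> 'a) filter \<Rightarrow> bool" where
  "compatible_uniformity X \<U> \<longleftrightarrow>
     uniformity_on (topspace X) \<U> \<and>
     (\<forall>W. openin X W \<longleftrightarrow>
        W \<subseteq> topspace X \<and> (\<forall>x\<in>W. eventually (\<lambda>(x', y). x' = x \<longrightarrow> y \<in> W) \<U>))"

text \<open>In the order of filters \<open>\<U> \<le> \<V>\<close> means that \<open>\<U>\<close> has more entourages than \<open>\<V>\<close>,
  so the finest uniformity is the least one.\<close>

definition finest_compatible_uniformity :: "'a topology \<Rightarrow> ('a \<times> 'a) filter" where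
  "finest_compatible_uniformity X = (LEAST \<U>. compatible_uniformity X \<U>)"

definition abelian_topological_group :: "('g, 'm) monoid_scheme \<Rightarrow> 'g topology \<Rightarrow> bool" where
  "abelian_topological_group G T \<longleftrightarrow>
     comm_group G \<and> topspace T = carrier G \<and>
     continuous_map (prod_topology T T) T (\<lambda>(x, y). x \<otimes>\<^bsub>G\<^esub> y) \<and>
     continuous_map T T (\<lambda>x. inv\<^bsub>G\<^esub> x)"

definition has_local_omega_omega_base :: "('g, 'm) monoid_scheme \<Rightarrow> 'g topology \<Rightarrow> bool" where
  "has_local_omega_omega_base G T \<longleftrightarrow> has_omega_omega_base (nhdsin T \<one>\<^bsub>G\<^esub>)"

text \<open>\<open>G\<close> with topology \<open>T\<close> is the free Abelian topological group on \<open>X\<close>, where \<open>X\<close> is regarded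
  as a subspace of \<open>G\<close> along \<open>\<iota>\<close>. A formula cannot quantify over the types of the target groups
  \<open>H\<close>, so their elements are taken from \<^typ>\<open>'a \<Rightarrow>\<^sub>0 int\<close>. This type is large enough to contain
  a copy of every Abelian group generated by an image of \<open>X\<close>, so that the extension property
  for targets in arbitrary types follows; see \<open>free_abelian_topological_group_extension\<close>.\<close>

definition free_abelian_topological_group ::
    "'a topology \<Rightarrow> ('g, 'm) monoid_scheme \<Rightarrow> 'g topology \<Rightarrow> ('a \<Rightarrow> 'g) \<Rightarrow> bool" where
  "free_abelian_topological_group X G T \<iota> \<longleftrightarrow>
     abelian_topological_group G T \<and>
     embedding_map X T \<iota> \<and>
     generate G (\<iota> ` topspace X) = carrier G \<and>
     (\<forall>(H :: ('a \<Rightarrow>\<^sub>0 int) monoid) S f.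
        abelian_topological_group H S \<longrightarrow> continuous_map X S f \<longrightarrow>
        (\<exists>\<phi> \<in> hom G H. continuous_map T S \<phi> \<and> (\<forall>x\<in>topspace X. \<phi> (\<iota> x) = f x)))"

lemma free_abelian_topological_group_extension:
  fixes X :: "'a topology" and G :: "('g, 'm) monoid_scheme"
    and H :: "('h, 'n) monoid_scheme"
  assumes free: "free_abelian_topological_group X G T \<iota>"
    and H: "abelian_topological_group H S"
    and f: "continuous_map X S f"
  shows "\<exists>\<phi> \<in> hom G H. continuous_map T S \<phi> \<and> (\<forall>x\<in>topspace X. \<phi> (\<iota> x) = f x)"
proof -
  interpret H: comm_group H
    using H by (simp add: abelian_topological_group_def)
  have S: "topspace S = carrier H"
    and mult: "continuous_map (prod_topology S S) S (\<lambda>(x, y). x \<otimes>\<^bsub>H\<^esub> y)"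
    and minv: "continuous_map S S (\<lambda>x. inv\<^bsub>H\<^esub> x)"
    using H by (auto simp: abelian_topological_group_def)
  define K where "K = free_Abelian_group (topspace X)"
  have "f ` topspace X \<subseteq> carrier H"
    using f S continuous_map_image_subset_topspace by blast
  then obtain p where p: "p \<in> hom K H" and pf: "\<And>x. x \<in> topspace X \<Longrightarrow> p (frag_of x) = f x"
    unfolding K_def using H.free_Abelian_group_universal by blast
  have "group K" by (simp add: K_def)
  then interpret p: group_hom K H p
    using p by (simp add: group_hom_def group_hom_axioms_def)
  define R where "R = p ` carrier K"
  have R: "subgroup R H"
    unfolding R_def by (rule p.img_is_subgroup)
  define j where "j = inv_into (carrier K) p"
  have pj: "p (j r) = r" if "r \<in> R" for r
    using that by (simp add: R_def j_def f_inv_into_f)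
  define C where "C = j ` R"
  have jC: "j r \<in> C" if "r \<in> R" for r using that by (simp add: C_def)
  have pC: "p c \<in> R" and jp: "j (p c) = c" if "c \<in> C" for c
    using that pj by (auto simp: C_def)
  have RH: "r \<in> carrier H" if "r \<in> R" for r using R that subgroup.mem_carrier by fast
  have Rm: "r \<otimes>\<^bsub>H\<^esub> s \<in> R" if "r \<in> R" "s \<in> R" for r s
    using R that by (simp add: subgroup.m_closed)
  have Ri: "inv\<^bsub>H\<^esub> r \<in> R" if "r \<in> R" for r using R that by (simp add: subgroup.m_inv_closed)
  have R1: "\<one>\<^bsub>H\<^esub> \<in> R" using R by (simp add: subgroup.one_closed)
  define H' :: "('a \<Rightarrow>\<^sub>0 int) monoid" where
    "H' = \<lparr>carrier = C, monoid.mult = (\<lambda>a b. j (p a \<otimes>\<^bsub>H\<^esub> p b)), one = j \<one>\<^bsub>H\<^esub>\<rparr>"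
  have H'_simps: "carrier H' = C" "a \<otimes>\<^bsub>H'\<^esub> b = j (p a \<otimes>\<^bsub>H\<^esub> p b)" "\<one>\<^bsub>H'\<^esub> = j \<one>\<^bsub>H\<^esub>" for a b
    by (simp_all add: H'_def)
  have H'_group: "comm_group H'"
  proof (rule comm_groupI)
    fix x assume x: "x \<in> carrier H'"
    then show "\<exists>y\<in>carrier H'. y \<otimes>\<^bsub>H'\<^esub> x = \<one>\<^bsub>H'\<^esub>"
      by (intro bexI[of _ "j (inv\<^bsub>H\<^esub> (p x))"])
        (simp_all add: H'_simps jC pC pj RH Ri)
  qed (simp_all add: H'_simps jC pC jp pj RH Rm R1 H.m_ac)
  have H'_inv: "inv\<^bsub>H'\<^esub> x = j (inv\<^bsub>H\<^esub> (p x))" if "x \<in> C" for x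
  proof (rule group.inv_equality)
    show "group H'" using H'_group by (simp add: comm_group_def)
  qed (use that in \<open>simp_all add: H'_simps jC pC pj RH Ri\<close>)
  define S' where "S' = pullback_topology C p S"
  have S'_top: "topspace S' = C"
    using pC RH S by (auto simp: S'_def topspace_pullback_topology)
  have p_cont: "continuous_map S' S p"
    using continuous_map_pullback[of S S id C p] by (simp add: S'_def)
  have into: "continuous_map Y S' g"
    if "continuous_map Y S (p \<circ> g)" "g ` topspace Y \<subseteq> C" for Y :: "'y topology" and g
    unfolding S'_def using that by (intro continuous_map_pullback') auto
  have H': "abelian_topological_group H' S'"
    unfolding abelian_topological_group_def
  proof (intro conjI)
    have "continuous_map (prod_topology S' S') (prod_topology S S) (\<lambda>z. (p (fst z), p (snd z)))"
      by (intro continuous_map_pairedI continuous_map_compose[OF _ p_cont, unfolded o_def]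
          continuous_map_fst continuous_map_snd)
    from continuous_map_compose[OF this mult]
    have *: "continuous_map (prod_topology S' S') S (\<lambda>z. p (fst z) \<otimes>\<^bsub>H\<^esub> p (snd z))"
      by (simp add: o_def)
    show "continuous_map (prod_topology S' S') S' (\<lambda>(x, y). x \<otimes>\<^bsub>H'\<^esub> y)"
      by (rule into, rule continuous_map_eq[OF *])
        (auto simp: S'_top H'_simps pj jC pC Rm)
    have *: "continuous_map S' S (\<lambda>x. inv\<^bsub>H\<^esub> (p x))"
      using continuous_map_compose[OF p_cont minv] by (simp add: o_def)
    show "continuous_map S' S' (\<lambda>x. inv\<^bsub>H'\<^esub> x)"
      by (rule into, rule continuous_map_eq[OF *])
        (auto simp: S'_top H'_inv pj jC pC Ri)
  qed (simp_all add: H'_group H'_simps S'_top)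
  have fR: "f x \<in> R" if "x \<in> topspace X" for x
    unfolding R_def using that pf[OF that] by (intro image_eqI[of _ p "frag_of x"]) (auto simp: K_def)
  have "continuous_map X S' (j \<circ> f)"
    by (rule into, rule continuous_map_eq[OF f]) (auto simp: pj fR jC)
  with free H' obtain \<psi> where \<psi>: "\<psi> \<in> hom G H'" "continuous_map T S' \<psi>"
    "\<And>x. x \<in> topspace X \<Longrightarrow> \<psi> (\<iota> x) = j (f x)"
    unfolding free_abelian_topological_group_def by fastforce
  have "p \<in> hom H' H"
    by (rule homI) (simp_all add: H'_simps pj pC RH Rm)
  with \<psi>(1) have "p \<circ> \<psi> \<in> hom G H" by (rule hom_compose)
  moreover have "continuous_map T S (p \<circ> \<psi>)"
    using \<psi>(2) p_cont by (rule continuous_map_compose)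
  ultimately show ?thesis
    using \<psi>(3) by (intro bexI[of _ "p \<circ> \<psi>"]) (auto simp: pj fR)
qed

end

theory Submission
  imports Defs
begin

text \<open>The finest compatible uniformity \<open>\<U>\<close> exists because the compatible uniformities are closed
  under suprema and the group uniformity of \<open>A(X)\<close> restricts to one. For a sequence \<open>E\<close> of
  entourages of \<open>\<U>\<close> consider all finite sums \<open>\<Sum> (x\<^sub>i - y\<^sub>i)\<close> with \<open>(x\<^sub>i, y\<^sub>i) \<in> E i\<close>, each index
  being used at most once. These sets are a neighbourhood base of zero for a group topology on
  the algebraic free Abelian group, and the universal property identifies it with the topology
  of \<open>A(X)\<close>. Hence an \<open>\<omega>\<^sup>\<omega>\<close>-base of \<open>\<U>\<close> yields one of \<open>A(X)\<close>, because a sequence of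
  elements of \<open>\<omega>\<^sup>\<omega>\<close> is again an element of \<open>\<omega>\<^sup>\<omega>\<close>. Conversely, if \<open>x - y\<close> is such a sum,
  its terms can be arranged to a walk from \<open>x\<close> to \<open>y\<close>; so if the \<open>E i\<close> shrink fast enough then
  \<open>(x, y)\<close> lies in a prescribed entourage, which shows that \<open>\<U>\<close> is induced by the group
  uniformity of \<open>A(X)\<close>.\<close>

subsection \<open>The finest compatible uniformity\<close>

lemma uniformity_onD:
  assumes "uniformity_on S \<U>"
  shows "eventually (\<lambda>p. p \<in> S \<times> S) \<U>"
    and "eventually P \<U> \<Longrightarrow> x \<in> S \<Longrightarrow> P (x, x)"
    and "eventually P \<U> \<Longrightarrow> eventually (\<lambda>(x, y). P (y, x)) \<U>"
    and "eventually P \<U> \<Longrightarrow>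
      \<exists>D. eventually D \<U> \<and> (\<forall>x y z. D (x, y) \<longrightarrow> D (y, z) \<longrightarrow> P (x, z))"
  using assms unfolding uniformity_on_def le_principal by blast+

text \<open>Compatibility is phrased through open sets only; this recovers that entourage balls are
  neighbourhoods of their centres. The witness \<open>W\<close> is the interior of the ball
  \<open>{z. P (x, z)}\<close>: the points around which some entourage ball still stays inside
  it.\<close>

lemma compatible_uniformity_nhd:
  assumes comp: "compatible_uniformity X \<U>" and P: "eventually P \<U>" and x: "x \<in> topspace X"
  obtains W where "openin X W" "x \<in> W" "\<And>y. y \<in> W \<Longrightarrow> P (x, y)"
proof
  have U: "uniformity_on (topspace X) \<U>"
    using comp by (simp add: compatible_uniformity_def)
  define W where "W = {y \<in> topspace X. eventually (\<lambda>(y', z). y' = y \<longrightarrow> P (x, z)) \<U>}"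
  have "\<forall>y\<in>W. eventually (\<lambda>(x', z). x' = y \<longrightarrow> z \<in> W) \<U>"
  proof
    fix y assume "y \<in> W"
    then have "eventually (\<lambda>(y', z). y' = y \<longrightarrow> P (x, z)) \<U>" by (simp add: W_def)
    \<comment> \<open>If \<open>z\<close> is \<open>D\<close>-close to \<open>y\<close>, the whole
      \<open>D\<close>-ball around \<open>z\<close> stays in \<open>{c. P (x, c)}\<close>, because
      two \<open>D\<close>-steps from \<open>y\<close> do. Hence \<open>z\<close> lies in
      \<open>W\<close> too.\<close>
    from uniformity_onD(4)[OF U this] obtain D where D: "eventually D \<U>"
      "\<And>a b c. D (a, b) \<Longrightarrow> D (b, c) \<Longrightarrow> a = y \<Longrightarrow> P (x, c)" by auto
    have "eventually (\<lambda>p. D p \<and> p \<in> topspace X \<times> topspace X) \<U>"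
      using D(1) uniformity_onD(1)[OF U] by (rule eventually_conj)
    then show "eventually (\<lambda>(x', z). x' = y \<longrightarrow> z \<in> W) \<U>"
    proof (rule eventually_mono, clarify)
      fix z assume z: "D (y, z)" "z \<in> topspace X"
      have "eventually (\<lambda>(y', c). y' = z \<longrightarrow> P (x, c)) \<U>"
        using D(1) by (rule eventually_mono) (use z D(2) in blast)
      then show "z \<in> W" using z by (simp add: W_def)
    qed
  qed
  moreover have "W \<subseteq> topspace X" by (auto simp: W_def)
  ultimately show "openin X W" using comp by (simp add: compatible_uniformity_def)
  show "x \<in> W" using P x by (auto simp: W_def elim: eventually_mono)
  show "P (x, y)" if "y \<in> W" for y
    using that uniformity_onD(2)[OF U, of "\<lambda>(y', z). y' = y \<longrightarrow> P (x, z)" y] by (auto simp: W_def)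
qed

text \<open>Refining a compatible uniformity keeps every open set open; the only danger is that too
  many sets become open, and \<open>nhd\<close> excludes this.\<close>

lemma compatible_uniformityI:
  assumes U: "uniformity_on (topspace X) \<U>"
    and le: "\<U> \<le> \<V>" and comp: "compatible_uniformity X \<V>"
    and nhd: "\<And>P x. eventually P \<U> \<Longrightarrow> x \<in> topspace X \<Longrightarrow>
      \<exists>W. openin X W \<and> x \<in> W \<and> (\<forall>y\<in>W. P (x, y))"
  shows "compatible_uniformity X \<U>"
  unfolding compatible_uniformity_def
proof (intro conjI allI U iffI)
  fix W
  show "W \<subseteq> topspace X" if "openin X W"
    using that by (rule openin_subset)
  show "\<forall>x\<in>W. eventually (\<lambda>(x', y). x' = x \<longrightarrow> y \<in> W) \<U>" if "openin X W"
    using that comp le unfolding compatible_uniformity_def le_filter_def by blast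
  assume W: "W \<subseteq> topspace X \<and> (\<forall>x\<in>W. eventually (\<lambda>(x', y). x' = x \<longrightarrow> y \<in> W) \<U>)"
  show "openin X W"
  proof (subst openin_subopen, intro ballI)
    fix x assume x: "x \<in> W"
    with W nhd[of "\<lambda>(x', y). x' = x \<longrightarrow> y \<in> W" x] obtain O' where
      "openin X O'" "x \<in> O'" "\<forall>y\<in>O'. y \<in> W" by auto
    then show "\<exists>V. openin X V \<and> x \<in> V \<and> V \<subseteq> W" by blast
  qed
qed

text \<open>An entourage of the infimum contains the intersection of one entourage of each, so its
  balls contain intersections of two neighbourhoods. The purpose is to make the family of compatible
  uniformities directed.\<close>

lemma compatible_uniformity_inf:
  assumes U: "compatible_uniformity X \<U>" and V: "compatible_uniformity X \<V>"
  shows "compatible_uniformity X (inf \<U> \<V>)"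
proof (rule compatible_uniformityI[OF _ _ U])
  note UV = U[unfolded compatible_uniformity_def, THEN conjunct1]
    V[unfolded compatible_uniformity_def, THEN conjunct1]
  show "uniformity_on (topspace X) (inf \<U> \<V>)"
    unfolding uniformity_on_def
  proof (intro conjI allI impI ballI)
    show "inf \<U> \<V> \<le> principal (topspace X \<times> topspace X)"
      using UV(1) by (auto simp: uniformity_on_def intro: le_infI1)
    fix E assume "eventually E (inf \<U> \<V>)"
    then obtain P Q where P: "eventually P \<U>" and Q: "eventually Q \<V>"
      and E: "\<And>p. P p \<Longrightarrow> Q p \<Longrightarrow> E p"
      unfolding eventually_inf by blast
    show "E (x, x)" if "x \<in> topspace X" for x
      using that P Q UV E by (blast dest: uniformity_onD(2))
    show "eventually (\<lambda>(x, y). E (y, x)) (inf \<U> \<V>)"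
      unfolding eventually_inf
      using uniformity_onD(3)[OF UV(1) P] uniformity_onD(3)[OF UV(2) Q] E by blast
    obtain A where A: "eventually A \<U>" "\<And>x y z. A (x, y) \<Longrightarrow> A (y, z) \<Longrightarrow> P (x, z)"
      using uniformity_onD(4)[OF UV(1) P] by blast
    obtain B where B: "eventually B \<V>" "\<And>x y z. B (x, y) \<Longrightarrow> B (y, z) \<Longrightarrow> Q (x, z)"
      using uniformity_onD(4)[OF UV(2) Q] by blast
    have "eventually (\<lambda>p. A p \<and> B p) (inf \<U> \<V>)"
      using A(1) B(1) unfolding eventually_inf by blast
    then show "\<exists>D. eventually D (inf \<U> \<V>) \<and> (\<forall>x y z. D (x, y) \<longrightarrow> D (y, z) \<longrightarrow> E (x, z))"
      using A(2) B(2) E by blast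
  qed
  fix R x assume "eventually R (inf \<U> \<V>)" and x: "x \<in> topspace X"
  then obtain P Q where P: "eventually P \<U>" and Q: "eventually Q \<V>"
    and R: "\<And>p. P p \<Longrightarrow> Q p \<Longrightarrow> R p"
    unfolding eventually_inf by blast
  obtain A where "openin X A" "x \<in> A" "\<And>y. y \<in> A \<Longrightarrow> P (x, y)"
    using compatible_uniformity_nhd[OF U P x] by blast
  moreover obtain B where "openin X B" "x \<in> B" "\<And>y. y \<in> B \<Longrightarrow> Q (x, y)"
    using compatible_uniformity_nhd[OF V Q x] by blast
  ultimately show "\<exists>W. openin X W \<and> x \<in> W \<and> (\<forall>y\<in>W. R (x, y))"
    using R by (intro exI[of _ "A \<inter> B"]) auto
qed simp

lemma
  assumes ex: "compatible_uniformity X \<V>"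
  shows compatible_finest_uniformity: "compatible_uniformity X (finest_compatible_uniformity X)"
    and finest_uniformity_le: "finest_compatible_uniformity X \<le> \<V>"
proof -
  define C where "C = {\<U>. compatible_uniformity X \<U>}"
  have V: "\<V> \<in> C" using ex by (simp add: C_def)
  \<comment> \<open>As \<open>C\<close> is nonempty and directed, an entourage of
    \<open>Inf C\<close> is already an entourage of a single member. The uniformity axioms and the
    neighbourhood condition are then inherited from that member.\<close>
  have ev: "eventually P (Inf C) \<longleftrightarrow> (\<exists>\<U>\<in>C. eventually P \<U>)" for P
  proof (rule eventually_Inf_base)
    show "\<exists>x\<in>C. x \<le> inf F G" if "F \<in> C" "G \<in> C" for F G
      using that compatible_uniformity_inf by (intro bexI[of _ "inf F G"]) (auto simp: C_def)
  qed (use V in auto)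
  have CU: "uniformity_on (topspace X) \<U>" if "\<U> \<in> C" for \<U>
    using that by (simp add: C_def compatible_uniformity_def)
  have "compatible_uniformity X (Inf C)"
  proof (rule compatible_uniformityI[OF _ _ ex])
    show "Inf C \<le> \<V>" using V by (rule Inf_lower)
    show "uniformity_on (topspace X) (Inf C)"
      unfolding uniformity_on_def le_principal
    proof (intro conjI allI impI ballI)
      show "eventually (\<lambda>p. p \<in> topspace X \<times> topspace X) (Inf C)"
        unfolding ev using V uniformity_onD(1)[OF CU[OF V]] by (rule bexI[rotated])
      fix E assume "eventually E (Inf C)"
      then obtain \<U> where \<U>: "\<U> \<in> C" "eventually E \<U>" unfolding ev by blast
      show "E (x, x)" if "x \<in> topspace X" for x
        using uniformity_onD(2)[OF CU] \<U> that by blast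
      show "eventually (\<lambda>(x, y). E (y, x)) (Inf C)"
        unfolding ev using uniformity_onD(3)[OF CU] \<U> by blast
      show "\<exists>D. eventually D (Inf C) \<and> (\<forall>x y z. D (x, y) \<longrightarrow> D (y, z) \<longrightarrow> E (x, z))"
        unfolding ev using uniformity_onD(4)[OF CU[OF \<U>(1)] \<U>(2)] \<U>(1) by blast
    qed
  next
    fix P x assume "eventually P (Inf C)" "x \<in> topspace X"
    then obtain \<U> where "compatible_uniformity X \<U>" "eventually P \<U>"
      unfolding ev by (auto simp: C_def)
    then show "\<exists>W. openin X W \<and> x \<in> W \<and> (\<forall>y\<in>W. P (x, y))"
      using \<open>x \<in> topspace X\<close> compatible_uniformity_nhd by metis
  qed
  moreover have "Inf C \<le> \<U>" if "compatible_uniformity X \<U>" for \<U>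
    using that by (intro Inf_lower) (simp add: C_def)
  ultimately have "finest_compatible_uniformity X = Inf C"
    unfolding finest_compatible_uniformity_def by (intro Least_equality) auto
  with \<open>compatible_uniformity X (Inf C)\<close> V
  show "compatible_uniformity X (finest_compatible_uniformity X)"
    and "finest_compatible_uniformity X \<le> \<V>"
    by (simp_all add: Inf_lower)
qed

subsection \<open>The uniformity of an Abelian topological group\<close>

text \<open>The trace on \<open>S\<close>, along \<open>\<iota>\<close>, of the
  translation-invariant uniformity of the group.\<close>

definition group_uniformity ::
    "('g, 'm) monoid_scheme \<Rightarrow> 'g topology \<Rightarrow> 'a set \<Rightarrow> ('a \<Rightarrow> 'g) \<Rightarrow> ('a \<times> 'a) filter" where
  "group_uniformity G T S \<iota> =
     inf (filtercomap (\<lambda>(x, y). \<iota> x \<otimes>\<^bsub>G\<^esub> inv\<^bsub>G\<^esub> \<iota> y) (nhdsin T \<one>\<^bsub>G\<^esub>)) (principal (S \<times> S))"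

locale abelian_top_group = comm_group G for G (structure) +
  fixes T
  assumes atg: "abelian_topological_group G T"
begin

lemma topspace_eq: "topspace T = carrier G"
  and continuous_mult: "continuous_map (prod_topology T T) T (\<lambda>(x, y). x \<otimes> y)"
  and continuous_inv: "continuous_map T T (\<lambda>x. inv x)"
  using atg by (auto simp: abelian_topological_group_def)

lemma eventually_nhds_one:
  "eventually P (nhdsin T \<one>) \<longleftrightarrow> (\<exists>W. openin T W \<and> \<one> \<in> W \<and> (\<forall>g\<in>W. P g))"
  by (simp add: eventually_nhdsin topspace_eq)

lemma continuous_div:
  assumes "continuous_map Y T f" "continuous_map Y T g"
  shows "continuous_map Y T (\<lambda>x. f x \<otimes> inv g x)"
proof -
  have "continuous_map Y (prod_topology T T) (\<lambda>x. (f x, inv g x))"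
    using assms continuous_map_compose[OF assms(2) continuous_inv]
    by (auto simp: continuous_map_pairwise o_def)
  from continuous_map_compose[OF this continuous_mult] show ?thesis by (simp add: o_def)
qed

lemma nhds_one_halve:
  assumes "openin T W" "\<one> \<in> W"
  obtains V where "openin T V" "\<one> \<in> V" "\<And>g h. g \<in> V \<Longrightarrow> h \<in> V \<Longrightarrow> g \<otimes> h \<in> W"
proof -
  have "openin (prod_topology T T) {p \<in> topspace (prod_topology T T). (\<lambda>(x, y). x \<otimes> y) p \<in> W}"
    using continuous_mult assms(1) by (rule openin_continuous_map_preimage)
  moreover have "(\<one>, \<one>) \<in> {p \<in> topspace (prod_topology T T). (\<lambda>(x, y). x \<otimes> y) p \<in> W}"
    using assms(2) by (simp add: topspace_eq)
  ultimately obtain A B where AB: "openin T A" "openin T B" "\<one> \<in> A" "\<one> \<in> B"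
    "A \<times> B \<subseteq> {p \<in> topspace (prod_topology T T). (\<lambda>(x, y). x \<otimes> y) p \<in> W}"
    unfolding openin_prod_topology_alt by meson
  show thesis
  proof
    show "openin T (A \<inter> B)" "\<one> \<in> A \<inter> B" using AB by auto
    show "g \<otimes> h \<in> W" if "g \<in> A \<inter> B" "h \<in> A \<inter> B" for g h
      using subsetD[OF AB(5), of "(g, h)"] that by simp
  qed
qed

lemma eventually_group_uniformity:
  "eventually P (group_uniformity G T S \<iota>) \<longleftrightarrow>
    (\<exists>W. openin T W \<and> \<one> \<in> W \<and> (\<forall>x\<in>S. \<forall>y\<in>S. \<iota> x \<otimes> inv \<iota> y \<in> W \<longrightarrow> P (x, y)))"
proof
  assume "eventually P (group_uniformity G T S \<iota>)"
  then obtain Q where Q: "eventually Q (nhdsin T \<one>)"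
    "\<forall>p. Q (case p of (x, y) \<Rightarrow> \<iota> x \<otimes> inv \<iota> y) \<longrightarrow> p \<in> S \<times> S \<longrightarrow> P p"
    unfolding group_uniformity_def eventually_inf_principal eventually_filtercomap by blast
  obtain W where W: "openin T W" "\<one> \<in> W" "\<And>g. g \<in> W \<Longrightarrow> Q g"
    using Q(1) unfolding eventually_nhds_one by blast
  have "P (x, y)" if "x \<in> S" "y \<in> S" "\<iota> x \<otimes> inv \<iota> y \<in> W" for x y
    using Q(2)[rule_format, of "(x, y)"] W(3) that by simp
  with W(1,2) show "\<exists>W. openin T W \<and> \<one> \<in> W \<and> (\<forall>x\<in>S. \<forall>y\<in>S. \<iota> x \<otimes> inv \<iota> y \<in> W \<longrightarrow> P (x, y))"
    by blast
next
  assume "\<exists>W. openin T W \<and> \<one> \<in> W \<and> (\<forall>x\<in>S. \<forall>y\<in>S. \<iota> x \<otimes> inv \<iota> y \<in> W \<longrightarrow> P (x, y))"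
  then obtain W where W: "openin T W" "\<one> \<in> W"
    "\<forall>x\<in>S. \<forall>y\<in>S. \<iota> x \<otimes> inv \<iota> y \<in> W \<longrightarrow> P (x, y)" by blast
  have "eventually (\<lambda>g. g \<in> W) (nhdsin T \<one>)"
    unfolding eventually_nhds_one using W(1,2) by blast
  then show "eventually P (group_uniformity G T S \<iota>)"
    unfolding group_uniformity_def eventually_inf_principal eventually_filtercomap
    using W(3) by (intro exI[of _ "\<lambda>g. g \<in> W"]) (simp add: split_beta)
qed

lemma uniformity_on_group_uniformity:
  assumes \<iota>: "\<And>x. x \<in> S \<Longrightarrow> \<iota> x \<in> carrier G"
  shows "uniformity_on S (group_uniformity G T S \<iota>)"
  unfolding uniformity_on_def
proof (intro conjI allI impI ballI)
  show "group_uniformity G T S \<iota> \<le> principal (S \<times> S)"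
    by (simp add: group_uniformity_def)
  fix E assume "eventually E (group_uniformity G T S \<iota>)"
  then obtain W where W: "openin T W" "\<one> \<in> W"
    "\<And>x y. x \<in> S \<Longrightarrow> y \<in> S \<Longrightarrow> \<iota> x \<otimes> inv \<iota> y \<in> W \<Longrightarrow> E (x, y)"
    unfolding eventually_group_uniformity by blast
  show "E (x, x)" if "x \<in> S" for x
    using W(2,3) that \<iota> by simp
  have "openin T {g \<in> topspace T. inv g \<in> W}"
    using continuous_inv W(1) by (rule openin_continuous_map_preimage)
  moreover have "\<one> \<in> {g \<in> topspace T. inv g \<in> W}"
    using W(2) by (simp add: topspace_eq)
  moreover have "inv (\<iota> x \<otimes> inv \<iota> y) = \<iota> y \<otimes> inv \<iota> x" if "x \<in> S" "y \<in> S" for x y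
    using that \<iota> by (simp add: inv_mult_group)
  ultimately show "eventually (\<lambda>(x, y). E (y, x)) (group_uniformity G T S \<iota>)"
    unfolding eventually_group_uniformity using W(3)
    by (intro exI[of _ "{g \<in> topspace T. inv g \<in> W}"]) auto
  obtain V where V: "openin T V" "\<one> \<in> V" "\<And>g h. g \<in> V \<Longrightarrow> h \<in> V \<Longrightarrow> g \<otimes> h \<in> W"
    using nhds_one_halve[OF W(1,2)] by blast
  show "\<exists>D. eventually D (group_uniformity G T S \<iota>) \<and>
      (\<forall>x y z. D (x, y) \<longrightarrow> D (y, z) \<longrightarrow> E (x, z))"
  proof (intro exI conjI allI impI)
    show "eventually (\<lambda>(x, y). x \<in> S \<and> y \<in> S \<and> \<iota> x \<otimes> inv \<iota> y \<in> V) (group_uniformity G T S \<iota>)"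
      unfolding eventually_group_uniformity using V by auto
    fix x y z
    assume "case (x, y) of (x, y) \<Rightarrow> x \<in> S \<and> y \<in> S \<and> \<iota> x \<otimes> inv \<iota> y \<in> V"
      and "case (y, z) of (x, y) \<Rightarrow> x \<in> S \<and> y \<in> S \<and> \<iota> x \<otimes> inv \<iota> y \<in> V"
    then have xyz: "x \<in> S" "y \<in> S" "z \<in> S" "\<iota> x \<otimes> inv \<iota> y \<in> V" "\<iota> y \<otimes> inv \<iota> z \<in> V" by auto
    have "(\<iota> x \<otimes> inv \<iota> y) \<otimes> (\<iota> y \<otimes> inv \<iota> z) = \<iota> x \<otimes> inv \<iota> z"
      using xyz \<iota> by (simp add: m_assoc) (simp flip: m_assoc)
    then show "E (x, z)" using V(3)[OF xyz(4,5)] W(3) xyz by simp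
  qed
qed

text \<open>In the group, points are close to a fixed point iff their quotients with it are close to
  the identity, since translations and inversion are continuous; the embedding transports this to
  \<open>X\<close>.\<close>

lemma compatible_group_uniformity:
  assumes emb: "embedding_map X T \<iota>"
  shows "compatible_uniformity X (group_uniformity G T (topspace X) \<iota>)"
  unfolding compatible_uniformity_def
proof (intro conjI allI iffI)
  have hom: "homeomorphic_map X (subtopology T (\<iota> ` topspace X)) \<iota>"
    using emb by (simp add: embedding_map_def)
  then have cont: "continuous_map X T \<iota>"
    by (meson continuous_map_in_subtopology homeomorphic_imp_continuous_map)
  have \<iota>: "\<iota> x \<in> carrier G" if "x \<in> topspace X" for x
    using cont that topspace_eq continuous_map_image_subset_topspace by fastforce
  show "uniformity_on (topspace X) (group_uniformity G T (topspace X) \<iota>)"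
    using \<iota> by (rule uniformity_on_group_uniformity)
  fix W
  show "W \<subseteq> topspace X" if "openin X W" using that by (rule openin_subset)
  show "\<forall>x\<in>W. eventually (\<lambda>(x', y). x' = x \<longrightarrow> y \<in> W) (group_uniformity G T (topspace X) \<iota>)"
    if W: "openin X W"
  proof
    fix x assume x: "x \<in> W"
    have WX: "W \<subseteq> topspace X" using W by (rule openin_subset)
    have x': "\<iota> x \<in> carrier G" using x WX \<iota> by blast
    have "openin (subtopology T (\<iota> ` topspace X)) (\<iota> ` W)"
      using hom W by (simp add: homeomorphic_map_openness WX)
    then obtain A where A: "openin T A" "\<iota> ` W = A \<inter> \<iota> ` topspace X"
      by (auto simp: openin_subtopology)
    have inj: "inj_on \<iota> (topspace X)"
      using hom by (rule homeomorphic_imp_injective_map)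
    \<comment> \<open>Chosen so that \<open>\<iota> x \<otimes> inv \<iota> y\<close> lies in
      \<open>B\<close> iff \<open>\<iota> y\<close> lies in \<open>A\<close>. The double inverse
      puts the expression into the quotient form of \<open>continuous_div\<close>.\<close>
    define B where "B = {g \<in> topspace T. inv g \<otimes> inv (inv \<iota> x) \<in> A}"
    have "continuous_map T T (\<lambda>g. inv g \<otimes> inv (inv \<iota> x))"
      using continuous_inv x' by (intro continuous_div) (auto simp: topspace_eq)
    then have "openin T B"
      unfolding B_def using A(1) by (rule openin_continuous_map_preimage)
    moreover have "\<one> \<in> B"
      using x A(2) x' by (auto simp: B_def topspace_eq)
    moreover have "y \<in> W" if y: "y \<in> topspace X" "\<iota> x \<otimes> inv \<iota> y \<in> B" for y
    proof -
      have "inv (\<iota> x \<otimes> inv \<iota> y) \<otimes> inv (inv \<iota> x) = \<iota> y"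
        using x' \<iota>[OF y(1)] by (simp add: inv_mult_group m_assoc)
      then have "\<iota> y \<in> \<iota> ` W" using y A(2) by (simp add: B_def)
      then show ?thesis using inj y(1) WX by (meson inj_on_image_mem_iff)
    qed
    ultimately show "eventually (\<lambda>(x', y). x' = x \<longrightarrow> y \<in> W) (group_uniformity G T (topspace X) \<iota>)"
      unfolding eventually_group_uniformity by (intro exI[of _ B]) auto
  qed
  assume W: "W \<subseteq> topspace X \<and>
    (\<forall>x\<in>W. eventually (\<lambda>(x', y). x' = x \<longrightarrow> y \<in> W) (group_uniformity G T (topspace X) \<iota>))"
  show "openin X W"
  proof (subst openin_subopen, intro ballI)
    fix x assume x: "x \<in> W"
    have xX: "x \<in> topspace X" using x W by blast
    then have x': "\<iota> x \<in> carrier G" by (rule \<iota>)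
    have "eventually (\<lambda>(x', y). x' = x \<longrightarrow> y \<in> W) (group_uniformity G T (topspace X) \<iota>)"
      using x W by blast
    then obtain A where A: "openin T A" "\<one> \<in> A" and
      "\<forall>x'\<in>topspace X. \<forall>y\<in>topspace X. \<iota> x' \<otimes> inv \<iota> y \<in> A \<longrightarrow>
        (case (x', y) of (x', y) \<Rightarrow> x' = x \<longrightarrow> y \<in> W)"
      unfolding eventually_group_uniformity by blast
    then have AW: "y \<in> W" if "y \<in> topspace X" "\<iota> x \<otimes> inv \<iota> y \<in> A" for y
      using that xX by simp
    have "continuous_map X T (\<lambda>y. \<iota> x \<otimes> inv \<iota> y)"
      using cont x' by (intro continuous_div) (auto simp: topspace_eq)
    then have "openin X {y \<in> topspace X. \<iota> x \<otimes> inv \<iota> y \<in> A}"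
      using A(1) by (rule openin_continuous_map_preimage)
    then show "\<exists>V. openin X V \<and> x \<in> V \<and> V \<subseteq> W"
      using xX A(2) AW x' by (intro exI[of _ "{y \<in> topspace X. \<iota> x \<otimes> inv \<iota> y \<in> A}"]) auto
  qed
qed

end

subsection \<open>Group topologies from neighbourhoods of zero\<close>

text \<open>The classical axioms for a neighbourhood base at zero of a group topology, for a group
  that fills its whole type. The members may fail to be open.\<close>

locale zero_nhds =
  fixes \<N> :: "'b::ab_group_add set set"
  assumes nonempty: "\<N> \<noteq> {}"
    and zero: "A \<in> \<N> \<Longrightarrow> 0 \<in> A"
    and inter: "A \<in> \<N> \<Longrightarrow> B \<in> \<N> \<Longrightarrow> \<exists>C\<in>\<N>. C \<subseteq> A \<inter> B"
    and halve: "A \<in> \<N> \<Longrightarrow> \<exists>B\<in>\<N>. \<forall>u\<in>B. \<forall>v\<in>B. u + v \<in> A"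
    and minus: "A \<in> \<N> \<Longrightarrow> \<exists>B\<in>\<N>. \<forall>v\<in>B. - v \<in> A"
begin

definition nhds_topology :: "'b topology" where
  "nhds_topology = topology (\<lambda>W. \<forall>w\<in>W. \<exists>A\<in>\<N>. \<forall>v\<in>A. w + v \<in> W)"

lemma openin_nhds_topology:
  "openin nhds_topology W \<longleftrightarrow> (\<forall>w\<in>W. \<exists>A\<in>\<N>. \<forall>v\<in>A. w + v \<in> W)"
proof -
  have "istopology (\<lambda>W. \<forall>w\<in>W. \<exists>A\<in>\<N>. \<forall>v\<in>A. w + v \<in> W)"
    unfolding istopology_def
  proof (intro conjI allI impI ballI)
    fix V W w
    assume "\<forall>w\<in>V. \<exists>A\<in>\<N>. \<forall>v\<in>A. w + v \<in> V" "\<forall>w\<in>W. \<exists>A\<in>\<N>. \<forall>v\<in>A. w + v \<in> W" "w \<in> V \<inter> W"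
    then obtain A B where "A \<in> \<N>" "B \<in> \<N>" "\<forall>v\<in>A. w + v \<in> V" "\<forall>v\<in>B. w + v \<in> W" by blast
    with inter[of A B] show "\<exists>A\<in>\<N>. \<forall>v\<in>A. w + v \<in> V \<inter> W" by blast
  next
    fix K w
    assume "\<forall>V\<in>K. \<forall>w\<in>V. \<exists>A\<in>\<N>. \<forall>v\<in>A. w + v \<in> V" "w \<in> \<Union>K"
    then show "\<exists>A\<in>\<N>. \<forall>v\<in>A. w + v \<in> \<Union>K" by (meson UnionE UnionI)
  qed
  then show ?thesis by (simp add: nhds_topology_def topology_inverse')
qed

lemma topspace_nhds_topology: "topspace nhds_topology = UNIV"
proof -
  have "openin nhds_topology UNIV"
    using nonempty by (auto simp: openin_nhds_topology)
  then show ?thesis using openin_subset by blast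
qed

text \<open>Since \<open>A\<close> may fail to be open, the translate \<open>a + A\<close> is
  replaced by its interior: the points \<open>w\<close> for which some \<open>w + B\<close> with
  \<open>B \<in> \<N>\<close> stays in \<open>a + A\<close>. Halving such a \<open>B\<close> shows
  that this set is open.\<close>

lemma nhds_topology_nhd:
  assumes A: "A \<in> \<N>"
  obtains W where "openin nhds_topology W" "a \<in> W" "\<And>w. w \<in> W \<Longrightarrow> w - a \<in> A"
proof
  define W where "W = {w. \<exists>B\<in>\<N>. \<forall>v\<in>B. w + v - a \<in> A}"
  show "a \<in> W" using A by (auto simp: W_def)
  show "w - a \<in> A" if "w \<in> W" for w
    using that zero by (fastforce simp: W_def)
  show "openin nhds_topology W"
    unfolding openin_nhds_topology
  proof
    fix w assume "w \<in> W"
    then obtain B where B: "B \<in> \<N>" "\<And>v. v \<in> B \<Longrightarrow> w + v - a \<in> A" by (auto simp: W_def)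
    obtain C where C: "C \<in> \<N>" "\<And>u v. u \<in> C \<Longrightarrow> v \<in> C \<Longrightarrow> u + v \<in> B"
      using halve[OF B(1)] by blast
    have "w + u \<in> W" if "u \<in> C" for u
      unfolding W_def using C B(2)[OF C(2)[OF that]] by (auto simp: add.assoc)
    with C(1) show "\<exists>A\<in>\<N>. \<forall>v\<in>A. w + v \<in> W" by blast
  qed
qed

lemma continuous_plus:
  "continuous_map (prod_topology nhds_topology nhds_topology) nhds_topology (\<lambda>(x, y). x + y)"
  unfolding continuous_map_alt
proof (intro conjI allI impI)
  fix W assume W: "openin nhds_topology W"
  show "openin (prod_topology nhds_topology nhds_topology)
    ((\<lambda>(x, y). x + y) -` W \<inter> topspace (prod_topology nhds_topology nhds_topology))"
    unfolding openin_prod_topology_alt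
  proof (intro allI impI)
    fix a b
    assume "(a, b) \<in> (\<lambda>(x, y). x + y) -` W \<inter> topspace (prod_topology nhds_topology nhds_topology)"
    then have "a + b \<in> W" by simp
    then obtain A where A: "A \<in> \<N>" "\<And>v. v \<in> A \<Longrightarrow> a + b + v \<in> W"
      using W by (auto simp: openin_nhds_topology)
    obtain B where B: "B \<in> \<N>" "\<And>u v. u \<in> B \<Longrightarrow> v \<in> B \<Longrightarrow> u + v \<in> A"
      using halve[OF A(1)] by blast
    obtain V1 where V1: "openin nhds_topology V1" "a \<in> V1" "\<And>w. w \<in> V1 \<Longrightarrow> w - a \<in> B"
      using nhds_topology_nhd[OF B(1)] by blast
    obtain V2 where V2: "openin nhds_topology V2" "b \<in> V2" "\<And>w. w \<in> V2 \<Longrightarrow> w - b \<in> B"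
      using nhds_topology_nhd[OF B(1)] by blast
    \<comment> \<open>Here \<open>c + d = (a + b) + ((c - a) + (d - b))\<close>, and the last
      bracket lies in \<open>A\<close>.\<close>
    have "c + d \<in> W" if "c \<in> V1" "d \<in> V2" for c d
      using A(2)[OF B(2)[OF V1(3)[OF that(1)] V2(3)[OF that(2)]]] by (simp add: algebra_simps)
    then show "\<exists>V1 V2. openin nhds_topology V1 \<and> openin nhds_topology V2 \<and> a \<in> V1 \<and> b \<in> V2 \<and>
        V1 \<times> V2 \<subseteq> (\<lambda>(x, y). x + y) -` W \<inter> topspace (prod_topology nhds_topology nhds_topology)"
      using V1 V2 by (intro exI[of _ V1] exI[of _ V2]) (auto simp: topspace_nhds_topology)
  qed
qed (simp add: topspace_nhds_topology)

lemma continuous_minus: "continuous_map nhds_topology nhds_topology (\<lambda>x. - x)"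
  unfolding continuous_map_alt
proof (intro conjI allI impI)
  fix W assume W: "openin nhds_topology W"
  show "openin nhds_topology ((\<lambda>x. - x) -` W \<inter> topspace nhds_topology)"
    unfolding openin_nhds_topology
  proof
    fix w assume "w \<in> (\<lambda>x. - x) -` W \<inter> topspace nhds_topology"
    then have "- w \<in> W" by simp
    then obtain A where A: "A \<in> \<N>" "\<And>v. v \<in> A \<Longrightarrow> - w + v \<in> W"
      using W unfolding openin_nhds_topology by blast
    obtain B where "B \<in> \<N>" "\<And>v. v \<in> B \<Longrightarrow> - v \<in> A"
      using minus[OF A(1)] by blast
    then show "\<exists>A\<in>\<N>. \<forall>v\<in>A. w + v \<in> (\<lambda>x. - x) -` W \<inter> topspace nhds_topology"
      using A(2) by (intro bexI[of _ B]) (fastforce simp: topspace_nhds_topology)+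
  qed
qed (simp add: topspace_nhds_topology)

end

subsection \<open>Neighbourhoods of zero in the free Abelian group\<close>

text \<open>The union of all finite partial sums of the sets consisting of zero and the differences
  of pairs in \<open>E n\<close>. Each relation contributes at most one difference, which keeps the
  sums small when \<open>E\<close> shrinks.\<close>

definition frag_sums :: "(nat \<Rightarrow> ('a \<times> 'a) set) \<Rightarrow> ('a \<Rightarrow>\<^sub>0 int) set" where
  "frag_sums E = {\<Sum>i\<in>I. frag_of (fst (p i)) - frag_of (snd (p i)) | I p.
     finite I \<and> (\<forall>i\<in>I. p i \<in> E i)}"

lemma frag_sumsI:
  "finite I \<Longrightarrow> (\<And>i. i \<in> I \<Longrightarrow> p i \<in> E i) \<Longrightarrow>
    (\<Sum>i\<in>I. frag_of (fst (p i)) - frag_of (snd (p i))) \<in> frag_sums E"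
  by (auto simp: frag_sums_def)

lemma frag_sumsE:
  assumes "v \<in> frag_sums E"
  obtains I p where "finite I" "\<And>i. i \<in> I \<Longrightarrow> p i \<in> E i"
    "v = (\<Sum>i\<in>I. frag_of (fst (p i)) - frag_of (snd (p i)))"
  using assms by (auto simp: frag_sums_def)

lemma zero_in_frag_sums: "0 \<in> frag_sums E"
  using frag_sumsI[of "{}" undefined E] by simp

lemma frag_diff_in_frag_sums: "(x, y) \<in> E 0 \<Longrightarrow> frag_of x - frag_of y \<in> frag_sums E"
  using frag_sumsI[of "{0}" "\<lambda>_. (x, y)" E] by simp

lemma frag_sums_mono: "(\<And>n. E n \<subseteq> F n) \<Longrightarrow> frag_sums E \<subseteq> frag_sums F"
  unfolding frag_sums_def by blast

lemma uminus_frag_sums: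
  assumes "v \<in> frag_sums (\<lambda>n. {(x, y). (y, x) \<in> E n})"
  shows "- v \<in> frag_sums E"
proof -
  from assms obtain I p where I: "finite I" "\<And>i. i \<in> I \<Longrightarrow> (snd (p i), fst (p i)) \<in> E i"
    and v: "v = (\<Sum>i\<in>I. frag_of (fst (p i)) - frag_of (snd (p i)))"
    by (elim frag_sumsE) (auto simp: split_beta)
  have "- v = (\<Sum>i\<in>I. frag_of (snd (p i)) - frag_of (fst (p i)))"
    by (simp add: v flip: sum_negf)
  then show ?thesis
    using frag_sumsI[of I "\<lambda>i. (snd (p i), fst (p i))" E] I by simp
qed

text \<open>Moving the indices of \<open>u\<close> to even and those of \<open>v\<close> to odd
  numbers keeps every index used at most once. The intersection makes the pair chosen at
  \<open>n\<close> admissible at both \<open>2 * n\<close> and \<open>Suc (2 * n)\<close>.\<close>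

lemma add_frag_sums:
  assumes "u \<in> frag_sums (\<lambda>n. E (2 * n) \<inter> E (Suc (2 * n)))"
    and "v \<in> frag_sums (\<lambda>n. E (2 * n) \<inter> E (Suc (2 * n)))"
  shows "u + v \<in> frag_sums E"
proof -
  obtain I p where I: "finite I" "\<And>i. i \<in> I \<Longrightarrow> p i \<in> E (2 * i) \<inter> E (Suc (2 * i))"
    and u: "u = (\<Sum>i\<in>I. frag_of (fst (p i)) - frag_of (snd (p i)))"
    using assms(1) by (rule frag_sumsE) blast
  obtain J q where J: "finite J" "\<And>i. i \<in> J \<Longrightarrow> q i \<in> E (2 * i) \<inter> E (Suc (2 * i))"
    and v: "v = (\<Sum>i\<in>J. frag_of (fst (q i)) - frag_of (snd (q i)))"
    using assms(2) by (rule frag_sumsE) blast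
  define I' J' where "I' = (\<lambda>i. 2 * i) ` I" and "J' = (\<lambda>i. Suc (2 * i)) ` J"
  define r where "r = (\<lambda>n. if even n then p (n div 2) else q (n div 2))"
  have u': "u = (\<Sum>i\<in>I'. frag_of (fst (r i)) - frag_of (snd (r i)))"
    unfolding u I'_def by (subst sum.reindex) (auto simp: inj_on_def r_def)
  have v': "v = (\<Sum>i\<in>J'. frag_of (fst (r i)) - frag_of (snd (r i)))"
    unfolding v J'_def by (subst sum.reindex) (auto simp: inj_on_def r_def)
  have fin: "finite I'" "finite J'" using I(1) J(1) by (auto simp: I'_def J'_def)
  have "I' \<inter> J' = {}" by (auto simp: I'_def J'_def) presburger
  then have "u + v = (\<Sum>i\<in>I' \<union> J'. frag_of (fst (r i)) - frag_of (snd (r i)))"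
    using fin by (simp add: u' v' sum.union_disjoint)
  moreover have "r i \<in> E i" if "i \<in> I' \<union> J'" for i
    using that I(2) J(2) by (auto simp: I'_def J'_def r_def)
  ultimately show ?thesis using fin by (auto intro!: frag_sumsI)
qed

definition frag_nhds :: "('a \<times> 'a) filter \<Rightarrow> ('a \<Rightarrow>\<^sub>0 int) set set" where
  "frag_nhds \<U> = {frag_sums E | E. \<forall>n. eventually (\<lambda>p. p \<in> E n) \<U>}"

lemma frag_nhdsI: "(\<And>n. eventually (\<lambda>p. p \<in> E n) \<U>) \<Longrightarrow> frag_sums E \<in> frag_nhds \<U>"
  by (auto simp: frag_nhds_def)

lemma frag_nhdsE:
  assumes "A \<in> frag_nhds \<U>"
  obtains E where "\<And>n. eventually (\<lambda>p. p \<in> E n) \<U>" "A = frag_sums E"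
  using assms by (auto simp: frag_nhds_def)

lemma zero_nhds_frag_nhds:
  assumes U: "uniformity_on S \<U>"
  shows "zero_nhds (frag_nhds \<U>)"
proof
  have "frag_sums (\<lambda>_. UNIV) \<in> frag_nhds \<U>" by (rule frag_nhdsI) simp
  then show "frag_nhds \<U> \<noteq> {}" by blast
next
  fix A assume A: "A \<in> frag_nhds \<U>"
  then obtain E where E: "\<And>n. eventually (\<lambda>p. p \<in> E n) \<U>" "A = frag_sums E"
    by (rule frag_nhdsE) blast
  show "0 \<in> A" by (simp add: E(2) zero_in_frag_sums)
  have "frag_sums (\<lambda>n. E (2 * n) \<inter> E (Suc (2 * n))) \<in> frag_nhds \<U>"
    by (intro frag_nhdsI) (use E(1) in \<open>simp add: eventually_conj_iff\<close>)
  then show "\<exists>B\<in>frag_nhds \<U>. \<forall>u\<in>B. \<forall>v\<in>B. u + v \<in> A"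
    using add_frag_sums E(2) by blast
  have "eventually (\<lambda>p. p \<in> {(x, y). (y, x) \<in> E n}) \<U>" for n
    using uniformity_onD(3)[OF U E(1)[of n]] by (rule eventually_mono) auto
  then have "frag_sums (\<lambda>n. {(x, y). (y, x) \<in> E n}) \<in> frag_nhds \<U>"
    by (rule frag_nhdsI)
  then show "\<exists>B\<in>frag_nhds \<U>. \<forall>v\<in>B. - v \<in> A"
    using uminus_frag_sums E(2) by blast
  fix B assume "B \<in> frag_nhds \<U>"
  then obtain F where F: "\<And>n. eventually (\<lambda>p. p \<in> F n) \<U>" "B = frag_sums F"
    by (rule frag_nhdsE) blast
  have "frag_sums (\<lambda>n. E n \<inter> F n) \<in> frag_nhds \<U>"
    by (intro frag_nhdsI) (use E(1) F(1) in \<open>simp add: eventually_conj_iff\<close>)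
  moreover have "frag_sums (\<lambda>n. E n \<inter> F n) \<subseteq> A \<inter> B"
    unfolding E(2) F(2) by (intro Int_greatest frag_sums_mono) auto
  ultimately show "\<exists>C\<in>frag_nhds \<U>. C \<subseteq> A \<inter> B" by blast
qed

section \<open>Walks along a sequence of relations\<close>

text \<open>The list records which relation each step takes, so that distinctness of the list says
  that no relation is taken twice.\<close>

fun chain :: "(nat \<Rightarrow> ('a \<times> 'a) set) \<Rightarrow> nat list \<Rightarrow> 'a \<Rightarrow> 'a \<Rightarrow> bool" where
  "chain E [] x y \<longleftrightarrow> x = y"
| "chain E (i # is) x y \<longleftrightarrow> (\<exists>z. (x, z) \<in> E i \<and> chain E is z y)"

lemma chain_append: "chain E (is @ js) x y \<longleftrightarrow> (\<exists>z. chain E is x z \<and> chain E js z y)"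
  by (induction "is" arbitrary: x) auto

text \<open>Read \<open>p i\<close> as an edge: the identity forces a trail from \<open>x\<close> to \<open>y\<close>, found greedily
  since the coefficient of the current vertex \<open>x \<noteq> y\<close> on the right-hand side is positive.\<close>

lemma chain_if_frag_sum:
  assumes "finite I" "\<And>i. i \<in> I \<Longrightarrow> p i \<in> E i"
    and "frag_of x - frag_of y = (\<Sum>i\<in>I. frag_of (fst (p i)) - frag_of (snd (p i)))"
  shows "\<exists>is. distinct is \<and> set is \<subseteq> I \<and> chain E is x y"
  using assms
proof (induction "card I" arbitrary: I x)
  case 0
  then have "frag_of x = frag_of y" by simp
  then have "chain E [] x y" by (simp add: frag_of_eq)
  then show ?case by (intro exI[of _ "[]"]) simp
next
  case (Suc n)
  show ?case
  proof (cases "x = y")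
    \<comment> \<open>The edges left over sum to zero and are discarded; therefore only an inclusion
      \<open>set is \<subseteq> I\<close> is claimed.\<close>
    case True
    then show ?thesis by (intro exI[of _ "[]"]) simp
  next
    case False
    have "\<exists>i\<in>I. fst (p i) = x"
    proof (rule ccontr)
      assume *: "\<not> (\<exists>i\<in>I. fst (p i) = x)"
      have "1 = Poly_Mapping.lookup (frag_of x - frag_of y) x"
        using False by (simp add: lookup_minus)
      also have "\<dots> = (\<Sum>i\<in>I. Poly_Mapping.lookup (frag_of (fst (p i)) - frag_of (snd (p i))) x)"
        by (simp add: Suc.prems(3) lookup_sum)
      also have "\<dots> \<le> 0"
        using * by (intro sum_nonpos) (auto simp: lookup_minus)
      finally show False by simp
    qed
    then obtain i where i: "i \<in> I" "fst (p i) = x" by blast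
    \<comment> \<open>Cancelling the edge \<open>i\<close> leaves the same kind of identity with its
      endpoint as the new start.\<close>
    have "frag_of (snd (p i)) - frag_of y =
        (\<Sum>i\<in>I - {i}. frag_of (fst (p i)) - frag_of (snd (p i)))"
      using Suc.prems(3) i(2) by (simp add: sum.remove[OF Suc.prems(1) i(1)] algebra_simps)
    moreover have "n = card (I - {i})"
      using Suc.hyps(2) i(1) by simp
    ultimately obtain "is" where "is": "distinct is" "set is \<subseteq> I - {i}" "chain E is (snd (p i)) y"
      using Suc.hyps(1)[of "I - {i}" "snd (p i)"] Suc.prems(1,2) by blast
    have "(x, snd (p i)) \<in> E i"
      using Suc.prems(2)[OF i(1)] i(2) by (metis prod.collapse)
    then show ?thesis using i(1) "is" by (intro exI[of _ "i # is"]) auto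
  qed
qed

text \<open>Splitting the walk at its smallest index \<open>m\<close> leaves two walks with larger indices, so
  three steps of \<open>D (Suc m)\<close> suffice.\<close>

lemma chain_contract:
  assumes refl: "\<And>n. Id \<subseteq> D n" and triple: "\<And>n. D (Suc n) O D (Suc n) O D (Suc n) \<subseteq> D n"
    and "distinct is" "set is \<subseteq> {m..<m + k}" "chain (\<lambda>i. D (Suc i)) is x y"
  shows "(x, y) \<in> D m"
  using assms(3-)
\<comment> \<open>The induction is on the length of the interval of allowed indices, not on the
  walk. Because of the shift, step \<open>m\<close> lies in \<open>D (Suc m)\<close>, the same
  relation into which walks with indices from \<open>Suc m\<close> on contract.\<close>
proof (induction k arbitrary: m "is" x y)
  case 0
  then show ?case using refl by auto
next
  case (Suc k)
  show ?case
  proof (cases "m \<in> set is")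
    case True
    then obtain as bs where "is": "is = as @ m # bs" by (meson split_list)
    then obtain z w where zw: "chain (\<lambda>i. D (Suc i)) as x z" "(z, w) \<in> D (Suc m)"
      "chain (\<lambda>i. D (Suc i)) bs w y"
      using Suc.prems(3) by (auto simp: chain_append)
    have "i \<in> {Suc m..<Suc m + k}" if "i \<in> set as \<union> set bs" for i
    proof -
      have "i \<noteq> m" "i \<in> {m..<m + Suc k}" using that Suc.prems(1,2) "is" by auto
      then show ?thesis by simp
    qed
    then have "set as \<subseteq> {Suc m..<Suc m + k}" "set bs \<subseteq> {Suc m..<Suc m + k}" by blast+
    moreover have "distinct as" "distinct bs" using Suc.prems(1) "is" by simp_all
    ultimately have "(x, z) \<in> D (Suc m)" "(w, y) \<in> D (Suc m)"
      using Suc.IH zw(1,3) by blast+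
    then show ?thesis using triple[of m] zw(2) by (meson relcompI subsetD)
  next
    \<comment> \<open>The index \<open>m\<close> does not occur, so the contracted walk is a single
      step, padded to three by reflexivity.\<close>
    case False
    moreover have "{m..<m + Suc k} = insert m {Suc m..<Suc m + k}" by auto
    ultimately have "set is \<subseteq> {Suc m..<Suc m + k}" using Suc.prems(2) by (simp add: subset_insert)
    then have "(x, y) \<in> D (Suc m)"
      using Suc.IH Suc.prems(1,3) by blast
    moreover have "(y, y) \<in> D (Suc m)" using refl by blast
    ultimately show ?thesis using triple[of m] by (meson relcompI subsetD)
  qed
qed

lemma uniformity_on_triple:
  assumes U: "uniformity_on S \<U>" and P: "eventually (\<lambda>p. p \<in> P) \<U>" "Id \<subseteq> P"
  shows "\<exists>D. (eventually (\<lambda>p. p \<in> D) \<U> \<and> Id \<subseteq> D) \<and> D O D O D \<subseteq> P"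
proof -
  have halve: "\<exists>D. eventually (\<lambda>p. p \<in> D) \<U> \<and> Id \<subseteq> D \<and> D O D \<subseteq> Q"
    if Q: "eventually (\<lambda>p. p \<in> Q) \<U>" "Id \<subseteq> Q" for Q
  proof -
    obtain R where R: "eventually R \<U>" "\<And>x y z. R (x, y) \<Longrightarrow> R (y, z) \<Longrightarrow> (x, z) \<in> Q"
      using uniformity_onD(4)[OF U Q(1)] by blast
    \<comment> \<open>Composing a pair of \<open>R\<close> with an identity step returns that pair,
      which must itself lie in \<open>Q\<close>; hence the intersection.\<close>
    have "eventually (\<lambda>p. p \<in> Id \<union> Q \<inter> Collect R) \<U>"
      using eventually_conj[OF Q(1) R(1)] by (rule eventually_mono) simp
    then show ?thesis using Q(2) R(2) by (intro exI[of _ "Id \<union> Q \<inter> Collect R"]) auto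
  qed
  obtain A where A: "eventually (\<lambda>p. p \<in> A) \<U>" "Id \<subseteq> A" "A O A \<subseteq> P"
    using halve[OF P] by blast
  obtain D where D: "eventually (\<lambda>p. p \<in> D) \<U>" "Id \<subseteq> D" "D O D \<subseteq> A"
    using halve[OF A(1,2)] by blast
  have "D O Id \<subseteq> D O D" using D(2) by (intro relcomp_mono) simp_all
  then have "D O D O D \<subseteq> A O A" using D(3) by (intro relcomp_mono) auto
  then have "D O D O D \<subseteq> P" using A(3) by (rule order_trans)
  with D(1,2) show ?thesis by blast
qed

text \<open>The topology given by \<open>frag_nhds\<close> is fine enough to recover
  \<open>\<U>\<close> on the generators: a sum equal to \<open>frag_of x - frag_of y\<close> yields
  a walk with distinct indices, and this walk contracts into a prescribed entourage.\<close>

lemma frag_nhds_entourage: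
  assumes U: "uniformity_on S \<U>" and P: "eventually P \<U>"
  obtains A where "A \<in> frag_nhds \<U>"
    "\<And>x y. x \<in> S \<Longrightarrow> frag_of x - frag_of y \<in> A \<Longrightarrow> P (x, y)"
proof -
  \<comment> \<open>The implication for \<open>n = 0\<close> carries the prescribed start of the
    sequence through the dependent choice.\<close>
  have "\<exists>D. \<forall>n. (eventually (\<lambda>p. p \<in> D n) \<U> \<and> Id \<subseteq> D n \<and> (n = 0 \<longrightarrow> D n = Id \<union> Collect P)) \<and>
      D (Suc n) O D (Suc n) O D (Suc n) \<subseteq> D n"
  proof (rule dependent_nat_choice)
    show "\<exists>D. eventually (\<lambda>p. p \<in> D) \<U> \<and> Id \<subseteq> D \<and> (0 = (0::nat) \<longrightarrow> D = Id \<union> Collect P)"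
      using P by (auto elim: eventually_mono)
  qed (use uniformity_on_triple[OF U] in auto)
  then obtain D where "\<And>n. (eventually (\<lambda>p. p \<in> D n) \<U> \<and> Id \<subseteq> D n \<and> (n = 0 \<longrightarrow> D n = Id \<union> Collect P)) \<and>
      D (Suc n) O D (Suc n) O D (Suc n) \<subseteq> D n" by blast
  then have D: "\<And>n. eventually (\<lambda>p. p \<in> D n) \<U>" "\<And>n. Id \<subseteq> D n"
    "D 0 = Id \<union> Collect P" "\<And>n. D (Suc n) O D (Suc n) O D (Suc n) \<subseteq> D n" by blast+
  show thesis
  proof
    show "frag_sums (\<lambda>n. D (Suc n)) \<in> frag_nhds \<U>" by (rule frag_nhdsI) (rule D(1))
    fix x y assume x: "x \<in> S" and "frag_of x - frag_of y \<in> frag_sums (\<lambda>n. D (Suc n))"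
    then obtain I p where I: "finite I" "\<And>i. i \<in> I \<Longrightarrow> p i \<in> D (Suc i)"
      "frag_of x - frag_of y = (\<Sum>i\<in>I. frag_of (fst (p i)) - frag_of (snd (p i)))"
      by (elim frag_sumsE) blast
    obtain "is" where "is": "distinct is" "set is \<subseteq> I" "chain (\<lambda>i. D (Suc i)) is x y"
      using chain_if_frag_sum[of I p "\<lambda>i. D (Suc i)"] I by blast
    obtain k where "I \<subseteq> {..<k}"
      using finite_nat_bounded[OF I(1)] by blast
    with "is" have "(x, y) \<in> D 0"
      by (intro chain_contract[of D "is" 0 k, OF D(2,4)]) auto
    \<comment> \<open>The diagonal was adjoined to \<open>D 0\<close> artificially; in the case
      \<open>x = y\<close> the claim comes from reflexivity at \<open>x \<in> S\<close>.\<close>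
    then show "P (x, y)"
      using D(3) uniformity_onD(2)[OF U P x] by auto
  qed
qed

section \<open>The topologized free Abelian group and its comparison with A(X)\<close>

text \<open>The whole type serves as the set of generators, so that the carrier is
  \<open>UNIV\<close> and the operations are those of the type class, as in
  \<open>zero_nhds\<close>.\<close>

lemma frag_nhds_abelian_topological_group:
  assumes U: "uniformity_on S \<U>"
  shows "abelian_topological_group (free_Abelian_group UNIV) (zero_nhds.nhds_topology (frag_nhds \<U>))"
proof -
  interpret zero_nhds "frag_nhds \<U>" using U by (rule zero_nhds_frag_nhds)
  show ?thesis
    unfolding abelian_topological_group_def mult_free_Abelian_group
      inv_free_Abelian_group[OF subset_UNIV]
    using continuous_plus continuous_minus
    by (auto simp: abelian_free_Abelian_group topspace_nhds_topology)
qed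

text \<open>For \<open>y\<close> near \<open>x\<close>, the difference
  \<open>frag_of y - frag_of x\<close> is a sum with the single index \<open>0\<close>. Since
  \<open>y\<close> comes first in it, the ball around \<open>x\<close> is taken for the reversed
  entourage.\<close>

lemma continuous_frag_of:
  assumes comp: "compatible_uniformity X \<U>"
  shows "continuous_map X (zero_nhds.nhds_topology (frag_nhds \<U>)) frag_of"
proof -
  have U: "uniformity_on (topspace X) \<U>"
    using comp by (simp add: compatible_uniformity_def)
  interpret zero_nhds "frag_nhds \<U>" using U by (rule zero_nhds_frag_nhds)
  show ?thesis
    unfolding continuous_map_alt
  proof (intro conjI allI impI)
    fix W assume W: "openin nhds_topology W"
    show "openin X (frag_of -` W \<inter> topspace X)"
    proof (subst openin_subopen, intro ballI)
      fix x assume x: "x \<in> frag_of -` W \<inter> topspace X"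
      then obtain E where E: "\<And>n. eventually (\<lambda>p. p \<in> E n) \<U>"
        "\<And>v. v \<in> frag_sums E \<Longrightarrow> frag_of x + v \<in> W"
        using W unfolding openin_nhds_topology by (metis IntD1 frag_nhdsE vimageD)
      obtain V where V: "openin X V" "x \<in> V" "\<And>y. y \<in> V \<Longrightarrow> (y, x) \<in> E 0"
        using compatible_uniformity_nhd[OF comp uniformity_onD(3)[OF U E(1)], of x 0] x by auto
      have "frag_of y \<in> W" if "y \<in> V" for y
        using E(2)[OF frag_diff_in_frag_sums[of y x E]] V(3)[OF that] by simp
      then show "\<exists>V. openin X V \<and> x \<in> V \<and> V \<subseteq> frag_of -` W \<inter> topspace X"
        using V openin_subset by blast
    qed
  qed (simp add: topspace_nhds_topology)
qed

text \<open>The universal property gives a continuous \<open>\<phi>\<close>, so preimages of basic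
  sets are neighbourhoods of the identity. Conversely, a neighbourhood of the identity contains such
  a preimage: \<open>le\<close> turns a shrinking sequence of neighbourhoods into entourages of
  \<open>\<U>\<close>, and an algebraic left inverse of \<open>\<phi>\<close> sends their sums back
  into the neighbourhood.\<close>

lemma free_abelian_topological_group_nhds:
  fixes G (structure)
  assumes free: "free_abelian_topological_group X G T \<iota>"
    and comp: "compatible_uniformity X \<U>"
    and le: "\<U> \<le> group_uniformity G T (topspace X) \<iota>"
  obtains \<phi> where "\<phi> \<in> hom G (free_Abelian_group UNIV)"
    "\<And>x. x \<in> topspace X \<Longrightarrow> \<phi> (\<iota> x) = frag_of x"
    "\<And>P. eventually P (nhdsin T \<one>) \<longleftrightarrow>
      (\<exists>A\<in>frag_nhds \<U>. \<forall>g\<in>carrier G. \<phi> g \<in> A \<longrightarrow> P g)"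
proof -
  have atg: "abelian_topological_group G T"
    and gen: "generate G (\<iota> ` topspace X) = carrier G"
    using free by (simp_all add: free_abelian_topological_group_def)
  interpret abelian_top_group G T
    using atg by (simp add: abelian_top_group_def abelian_top_group_axioms_def
        abelian_topological_group_def)
  have U: "uniformity_on (topspace X) \<U>"
    using comp by (simp add: compatible_uniformity_def)
  interpret zero_nhds "frag_nhds \<U>" using U by (rule zero_nhds_frag_nhds)
  have \<iota>: "\<iota> x \<in> carrier G" if "x \<in> topspace X" for x
    using that gen generate.incl[of "\<iota> x" "\<iota> ` topspace X" G] by auto
  obtain \<phi> where \<phi>: "\<phi> \<in> hom G (free_Abelian_group UNIV)"
    "continuous_map T nhds_topology \<phi>" "\<And>x. x \<in> topspace X \<Longrightarrow> \<phi> (\<iota> x) = frag_of x"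
    using free_abelian_topological_group_extension[OF free
        frag_nhds_abelian_topological_group[OF U] continuous_frag_of[OF comp]] by blast
  \<comment> \<open>Generators outside \<open>X\<close> exist because the free group is over the
    whole type; they are sent to the identity.\<close>
  have "(\<lambda>x. if x \<in> topspace X then \<iota> x else \<one>) ` UNIV \<subseteq> carrier G"
    using \<iota> by auto
  then obtain \<psi> where \<psi>: "\<psi> \<in> hom (free_Abelian_group UNIV) G"
    "\<And>x. \<psi> (frag_of x) = (if x \<in> topspace X then \<iota> x else \<one>)"
    by (rule free_Abelian_group_universal) auto
  interpret \<phi>: group_hom G "free_Abelian_group UNIV" \<phi>
    using \<phi>(1) by (simp add: group_hom_def group_hom_axioms_def)
  interpret \<psi>: group_hom "free_Abelian_group UNIV" G \<psi>
    using \<psi>(1) by (simp add: group_hom_def group_hom_axioms_def)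
  have \<psi>_add: "\<psi> (a + b) = \<psi> a \<otimes> \<psi> b" for a b
    using \<psi>.hom_mult[of a b] by simp
  have \<psi>_diff: "\<psi> (frag_of x - frag_of y) = \<iota> x \<otimes> inv \<iota> y"
    if "x \<in> topspace X" "y \<in> topspace X" for x y
    using \<psi>_add[of "frag_of x" "- frag_of y"] \<psi>.hom_inv[of "frag_of y"] \<psi>(2) that by simp
  have \<psi>\<phi>: "\<psi> (\<phi> g) = g" if "g \<in> carrier G" for g
  proof -
    \<comment> \<open>The homomorphism \<open>\<psi> \<circ> \<phi>\<close> fixes the generators of
      \<open>G\<close>, hence everything.\<close>
    from that have "g \<in> generate G (\<iota> ` topspace X)" by (simp add: gen)
    then show ?thesis
    proof induction
      case (eng g h)
      then have "g \<in> carrier G" "h \<in> carrier G" by (simp_all add: gen)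
      then show ?case
        using eng \<phi>.hom_mult \<psi>_add by simp
    next
      case (inv h)
      then have "h \<in> carrier G" using \<iota> by auto
      then have "\<psi> (\<phi> (inv h)) = inv (\<psi> (\<phi> h))"
        using \<psi>.hom_inv[of "\<phi> h"] by (simp add: \<phi>.hom_inv)
      then show ?case using inv \<phi>(3) \<psi>(2) by auto
    qed (use \<phi>(3) \<psi>(2) \<phi>.hom_one \<psi>.hom_one in auto)
  qed
  show thesis
  proof (rule that[OF \<phi>(1,3)])
    fix P
    show "eventually P (nhdsin T \<one>) \<longleftrightarrow> (\<exists>A\<in>frag_nhds \<U>. \<forall>g\<in>carrier G. \<phi> g \<in> A \<longrightarrow> P g)"
    proof
      assume "\<exists>A\<in>frag_nhds \<U>. \<forall>g\<in>carrier G. \<phi> g \<in> A \<longrightarrow> P g"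
      then obtain A where A: "A \<in> frag_nhds \<U>" "\<And>g. g \<in> carrier G \<Longrightarrow> \<phi> g \<in> A \<Longrightarrow> P g" by blast
      obtain V where V: "openin nhds_topology V" "0 \<in> V" "\<And>w. w \<in> V \<Longrightarrow> w - 0 \<in> A"
        using nhds_topology_nhd[OF A(1)] by blast
      have "openin T {g \<in> topspace T. \<phi> g \<in> V}"
        using \<phi>(2) V(1) by (rule openin_continuous_map_preimage)
      moreover have "\<one> \<in> {g \<in> topspace T. \<phi> g \<in> V}"
        using V(2) \<phi>.hom_one by (simp add: topspace_eq)
      moreover have "\<forall>g \<in> {g \<in> topspace T. \<phi> g \<in> V}. P g"
        using A(2) V(3) by (simp add: topspace_eq)
      ultimately show "eventually P (nhdsin T \<one>)"
        unfolding eventually_nhds_one by blast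
    next
      assume "eventually P (nhdsin T \<one>)"
      then obtain W0 where W0: "openin T W0" "\<one> \<in> W0" "\<And>g. g \<in> W0 \<Longrightarrow> P g"
        unfolding eventually_nhds_one by blast
      \<comment> \<open>Repeated halving, started at \<open>W0\<close>.\<close>
      have "\<exists>W. \<forall>n. (openin T (W n) \<and> \<one> \<in> W n \<and> (n = 0 \<longrightarrow> W n = W0)) \<and>
          (\<forall>g\<in>W (Suc n). \<forall>h\<in>W (Suc n). g \<otimes> h \<in> W n)"
      proof (rule dependent_nat_choice)
        fix V and n :: nat
        assume "openin T V \<and> \<one> \<in> V \<and> (n = 0 \<longrightarrow> V = W0)"
        then obtain V' where "openin T V'" "\<one> \<in> V'" "\<And>g h. g \<in> V' \<Longrightarrow> h \<in> V' \<Longrightarrow> g \<otimes> h \<in> V"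
          using nhds_one_halve[of V] by blast
        then show "\<exists>V'. (openin T V' \<and> \<one> \<in> V' \<and> (Suc n = 0 \<longrightarrow> V' = W0)) \<and>
            (\<forall>g\<in>V'. \<forall>h\<in>V'. g \<otimes> h \<in> V)" by auto
      qed (use W0 in auto)
      then obtain W where "\<And>n. (openin T (W n) \<and> \<one> \<in> W n \<and> (n = 0 \<longrightarrow> W n = W0)) \<and>
          (\<forall>g\<in>W (Suc n). \<forall>h\<in>W (Suc n). g \<otimes> h \<in> W n)" by blast
      then have W: "\<And>n. openin T (W n)" "\<And>n. \<one> \<in> W n" "W 0 = W0"
        "\<And>n g h. g \<in> W (Suc n) \<Longrightarrow> h \<in> W (Suc n) \<Longrightarrow> g \<otimes> h \<in> W n" by blast+
      \<comment> \<open>The index is shifted by one to leave room for the remaining terms: the term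
        at \<open>m\<close> and the sum over all later indices both lie in \<open>W (Suc m)\<close>,
        so their product lies in \<open>W m\<close>.\<close>
      define E where "E = (\<lambda>n. {(x, y). x \<in> topspace X \<and> y \<in> topspace X \<and>
        \<iota> x \<otimes> inv \<iota> y \<in> W (Suc n)})"
      have "eventually (\<lambda>p. p \<in> E n) (group_uniformity G T (topspace X) \<iota>)" for n
        unfolding eventually_group_uniformity E_def using W(1,2) by blast
      then have "frag_sums E \<in> frag_nhds \<U>"
        using le by (auto intro!: frag_nhdsI simp: le_filter_def)
      moreover have sum_W: "\<psi> (\<Sum>i\<in>I. frag_of (fst (p i)) - frag_of (snd (p i))) \<in> W m"
        if "I \<subseteq> {m..<m + k}" "\<And>i. i \<in> I \<Longrightarrow> p i \<in> E i" for I p m k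
        using that
      proof (induction k arbitrary: m I)
        case 0
        then show ?case using W(2) \<psi>.hom_one by simp
      next
        case (Suc k)
        let ?t = "\<lambda>i. frag_of (fst (p i)) - frag_of (snd (p i))"
        have fin: "finite I" using Suc.prems(1) finite_subset by blast
        have "I - {m} \<subseteq> {Suc m..<Suc m + k}"
          using Suc.prems(1) by auto
        then have IH: "\<psi> (sum ?t (I - {m})) \<in> W (Suc m)"
          using Suc.IH Suc.prems(2) by blast
        show ?case
        proof (cases "m \<in> I")
          case True
          then have "p m \<in> E m" by (rule Suc.prems(2))
          then have "\<psi> (?t m) \<in> W (Suc m)"
            using \<psi>_diff[of "fst (p m)" "snd (p m)"] by (auto simp: E_def split_beta)
          then have "\<psi> (?t m) \<otimes> \<psi> (sum ?t (I - {m})) \<in> W m"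
            using IH by (rule W(4))
          then show ?thesis
            by (simp only: sum.remove[OF fin True] \<psi>_add)
        next
          \<comment> \<open>Without a term at \<open>m\<close>, the identity takes its place as the
            second factor.\<close>
          case False
          then have "\<psi> (sum ?t I) \<otimes> \<one> \<in> W m"
            using W(4)[OF IH W(2)] by simp
          moreover have "\<psi> (sum ?t I) \<in> carrier G" by (rule \<psi>.hom_closed) simp
          ultimately show ?thesis by simp
        qed
      qed
      have "P g" if g: "g \<in> carrier G" "\<phi> g \<in> frag_sums E" for g
      proof -
        obtain I p where I: "finite I" "\<And>i. i \<in> I \<Longrightarrow> p i \<in> E i"
          "\<phi> g = (\<Sum>i\<in>I. frag_of (fst (p i)) - frag_of (snd (p i)))"
          using g(2) by (rule frag_sumsE) blast
        obtain k where "I \<subseteq> {..<k}"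
          using finite_nat_bounded[OF I(1)] by blast
        then have "I \<subseteq> {0..<0 + k}" by auto
        from sum_W[OF this I(2)] have "g \<in> W 0"
          using \<psi>\<phi>[OF g(1)] I(3) by simp
        then show ?thesis using W(3) W0(3) by simp
      qed
      ultimately show "\<exists>A\<in>frag_nhds \<U>. \<forall>g\<in>carrier G. \<phi> g \<in> A \<longrightarrow> P g" by blast
    qed
  qed
qed

section \<open>Transfer of bases between A(X) and the finest uniformity\<close>

theorem corollary3p20:
  fixes X :: "'a topology" and G :: "('g, 'm) monoid_scheme"
    and T :: "'g topology" and \<iota> :: "'a \<Rightarrow> 'g"
  assumes "tychonoff_space X"
    and "free_abelian_topological_group X G T \<iota>"
  shows "has_local_omega_omega_base G T \<longleftrightarrow>
    has_omega_omega_base (finest_compatible_uniformity X)"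
proof -
  define \<U> where "\<U> = finest_compatible_uniformity X"
  have atg: "abelian_topological_group G T" and emb: "embedding_map X T \<iota>"
    and gen: "generate G (\<iota> ` topspace X) = carrier G"
    using assms(2) by (simp_all add: free_abelian_topological_group_def)
  interpret abelian_top_group G T
    using atg by (simp add: abelian_top_group_def abelian_top_group_axioms_def
        abelian_topological_group_def)
  have \<iota>: "\<iota> x \<in> carrier G" if "x \<in> topspace X" for x
    using that gen generate.incl[of "\<iota> x" "\<iota> ` topspace X" G] by auto
  \<comment> \<open>The uniformity inherited from A(X) witnesses that compatible uniformities exist,
    and the finest one lies below it.\<close>
  note compatible = compatible_group_uniformity[OF emb]
  have comp: "compatible_uniformity X \<U>" and le: "\<U> \<le> group_uniformity G T (topspace X) \<iota>"
    unfolding \<U>_def using compatible_finest_uniformity[OF compatible]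
      finest_uniformity_le[OF compatible] by simp_all
  have U: "uniformity_on (topspace X) \<U>"
    using comp by (simp add: compatible_uniformity_def)
  obtain \<phi> where \<phi>: "\<phi> \<in> hom G (free_Abelian_group UNIV)"
    "\<And>x. x \<in> topspace X \<Longrightarrow> \<phi> (\<iota> x) = frag_of x"
    and nhds: "\<And>P. eventually P (nhdsin T \<one>\<^bsub>G\<^esub>) \<longleftrightarrow>
      (\<exists>A\<in>frag_nhds \<U>. \<forall>g\<in>carrier G. \<phi> g \<in> A \<longrightarrow> P g)"
    using free_abelian_topological_group_nhds[OF assms(2) comp le] by blast
  interpret \<phi>: group_hom G "free_Abelian_group UNIV" \<phi>
    using \<phi>(1) by (simp add: group_hom_def group_hom_axioms_def)
  have \<phi>_diff: "\<phi> (\<iota> x \<otimes>\<^bsub>G\<^esub> inv\<^bsub>G\<^esub> \<iota> y) = frag_of x - frag_of y"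
    if "x \<in> topspace X" "y \<in> topspace X" for x y
    using that \<iota> \<phi>(2) by (simp add: \<phi>.hom_inv)
  have "has_omega_omega_base \<U>" if "has_omega_omega_base (nhdsin T \<one>\<^bsub>G\<^esub>)"
  proof -
    obtain F where F: "\<And>\<alpha>. eventually (\<lambda>g. g \<in> F \<alpha>) (nhdsin T \<one>\<^bsub>G\<^esub>)"
      "\<And>\<alpha> \<beta> :: nat \<Rightarrow> nat. \<alpha> \<le> \<beta> \<Longrightarrow> F \<beta> \<subseteq> F \<alpha>"
      "\<And>A. eventually (\<lambda>g. g \<in> A) (nhdsin T \<one>\<^bsub>G\<^esub>) \<Longrightarrow> \<exists>\<alpha>. F \<alpha> \<subseteq> A"
      using \<open>has_omega_omega_base (nhdsin T \<one>\<^bsub>G\<^esub>)\<close> unfolding has_omega_omega_base_def by blast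
    \<comment> \<open>The base at the identity is pulled back along the quotient map. Monotonicity
      is immediate; that the sets \<open>E \<alpha>\<close> are small enough rests on
      \<open>frag_nhds_entourage\<close>.\<close>
    define E where "E = (\<lambda>\<alpha>. {(x, y). x \<in> topspace X \<and> y \<in> topspace X \<and> \<iota> x \<otimes>\<^bsub>G\<^esub> inv\<^bsub>G\<^esub> \<iota> y \<in> F \<alpha>})"
    have "eventually (\<lambda>p. p \<in> E \<alpha>) \<U>" for \<alpha>
    proof -
      have "eventually (\<lambda>p. p \<in> E \<alpha>) (group_uniformity G T (topspace X) \<iota>)"
        using F(1)[of \<alpha>] unfolding eventually_group_uniformity eventually_nhds_one E_def by auto
      then show ?thesis using le by (simp add: le_filter_def)
    qed
    moreover have "E \<beta> \<subseteq> E \<alpha>" if "\<alpha> \<le> \<beta>" for \<alpha> \<beta>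
      using F(2)[OF that] by (auto simp: E_def)
    moreover have "\<exists>\<alpha>. E \<alpha> \<subseteq> P" if P: "eventually (\<lambda>p. p \<in> P) \<U>" for P
    proof -
      obtain A where A: "A \<in> frag_nhds \<U>"
        "\<And>x y. x \<in> topspace X \<Longrightarrow> frag_of x - frag_of y \<in> A \<Longrightarrow> (x, y) \<in> P"
        using frag_nhds_entourage[OF U P] by blast
      have "eventually (\<lambda>g. g \<in> {g. \<phi> g \<in> A}) (nhdsin T \<one>\<^bsub>G\<^esub>)"
        unfolding nhds using A(1) by blast
      from F(3)[OF this] obtain \<alpha> where "F \<alpha> \<subseteq> {g. \<phi> g \<in> A}" by blast
      then have "E \<alpha> \<subseteq> P" using A(2) \<phi>_diff by (auto simp: E_def)
      then show ?thesis by blast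
    qed
    ultimately show ?thesis unfolding has_omega_omega_base_def by blast
  qed
  moreover have "has_omega_omega_base (nhdsin T \<one>\<^bsub>G\<^esub>)" if "has_omega_omega_base \<U>"
  proof -
    obtain F where F: "\<And>\<alpha>. eventually (\<lambda>p. p \<in> F \<alpha>) \<U>"
      "\<And>\<alpha> \<beta> :: nat \<Rightarrow> nat. \<alpha> \<le> \<beta> \<Longrightarrow> F \<beta> \<subseteq> F \<alpha>"
      "\<And>P. eventually (\<lambda>p. p \<in> P) \<U> \<Longrightarrow> \<exists>\<alpha>. F \<alpha> \<subseteq> P"
      using \<open>has_omega_omega_base \<U>\<close> unfolding has_omega_omega_base_def by blast
    \<comment> \<open>Through the pairing of natural numbers, \<open>\<alpha>\<close> is read as a
      matrix whose row \<open>n\<close> selects the entourage for index \<open>n\<close>. Reading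
      off rows is monotone, so the pointwise order is respected.\<close>
    define B where "B = (\<lambda>\<alpha>. {g \<in> carrier G.
      \<phi> g \<in> frag_sums (\<lambda>n. F (\<lambda>k. \<alpha> (prod_encode (n, k))))})"
    have "eventually (\<lambda>g. g \<in> B \<alpha>) (nhdsin T \<one>\<^bsub>G\<^esub>)" for \<alpha>
      unfolding nhds B_def using frag_nhdsI[of "\<lambda>n. F (\<lambda>k. \<alpha> (prod_encode (n, k)))", OF F(1)] by blast
    moreover have "B \<beta> \<subseteq> B \<alpha>" if "\<alpha> \<le> \<beta>" for \<alpha> \<beta>
    proof -
      have "frag_sums (\<lambda>n. F (\<lambda>k. \<beta> (prod_encode (n, k)))) \<subseteq>
          frag_sums (\<lambda>n. F (\<lambda>k. \<alpha> (prod_encode (n, k))))"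
        using that by (intro frag_sums_mono F(2)) (simp add: le_fun_def)
      then show ?thesis by (auto simp: B_def)
    qed
    moreover have "\<exists>\<alpha>. B \<alpha> \<subseteq> A" if A: "eventually (\<lambda>g. g \<in> A) (nhdsin T \<one>\<^bsub>G\<^esub>)" for A
    proof -
      obtain V where V: "V \<in> frag_nhds \<U>" "\<And>g. g \<in> carrier G \<Longrightarrow> \<phi> g \<in> V \<Longrightarrow> g \<in> A"
        using A unfolding nhds by blast
      obtain E where E: "\<And>n. eventually (\<lambda>p. p \<in> E n) \<U>" "V = frag_sums E"
        using V(1) by (rule frag_nhdsE) blast
      obtain a where a: "\<And>n. F (a n) \<subseteq> E n"
        using F(3)[OF E(1)] by metis
      \<comment> \<open>Conversely, the countably many functions \<open>a n\<close> are packed into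
        one as its rows.\<close>
      define \<alpha> where "\<alpha> = (\<lambda>m. case prod_decode m of (n, k) \<Rightarrow> a n k)"
      have "(\<lambda>k. \<alpha> (prod_encode (n, k))) = a n" for n by (simp add: \<alpha>_def)
      then have "B \<alpha> \<subseteq> A"
        using V(2) E(2) frag_sums_mono[of "\<lambda>n. F (a n)" E, OF a] by (auto simp: B_def)
      then show ?thesis by blast
    qed
    ultimately show ?thesis unfolding has_omega_omega_base_def by blast
  qed
  ultimately show ?thesis
    unfolding has_local_omega_omega_base_def \<U>_def by blast
qed

end
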